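(* Let $X$ be a set with bornology $\mathcal{B}$. Let $\ll$ be a binary relation on the power set of $X$ satisfying, for all subsets $A,B,B_1,B_2,C,D$ of $X$: (1) $X\ll (X\setminus D)$ for all $D\in\mathcal{B}$; (2) $A\ll B$ implies that there exists $D\in\mathcal{B}$ such that $A\setminus D\subseteq B$; (3) $A\subseteq B\ll C\subseteq D$ implies $A\ll D$; (4) $A\ll B_1$ and $A\ll B_2$ if and only if $A\ll (B_1\cap B_2)$; (5) $A\ll B$ if and only if $(X\setminus B)\ll (X\setminus A)$; (6) $A\ll B$ implies that there exists $C\subseteq X$ such that $A\ll C\ll B$. Let $\mathbf{b}$ be the relation on the power set of $X$ defined by \[A\bar{\mathbf{b}}B \quad\text{if and only if}\quad A\ll (X\setminus B),\] where $A\bar{\mathbf{b}}B$ means that $A\mathbf{b}B$ does not hold. Then $\mathbf{b}$ is a coarse proximity on $X$ (with respect to $\mathcal{B}$). Also, for $A,B\subseteq X$, $B$ is a $\mathbf{b}$-coarse neighborhood of $A$ if and only if $A\ll B$.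
   Context: A bornology on a set $X$ is a family $\mathcal{B}$ of subsets of $X$ such that: $\{x\}\in\mathcal{B}$ for all $x\in X$; $A\in\mathcal{B}$ and $B\subseteq A$ imply $B\in\mathcal{B}$; $A,B\in\mathcal{B}$ implies $A\cup B\in\mathcal{B}$. A coarse proximity on a set $X$ with bornology $\mathcal{B}$ is a relation $\mathbf{b}$ on the power set of $X$ such that for all $A,B,C\subseteq X$: (i) $A\mathbf{b}B$ implies $B\mathbf{b}A$; (ii) $A\mathbf{b}B$ implies $A\notin\mathcal{B}$ and $B\notin\mathcal{B}$; (iii) $A\cap B\notin\mathcal{B}$ implies $A\mathbf{b}B$; (iv) $(A\cup B)\mathbf{b}C$ if and only if $A\mathbf{b}C$ or $B\mathbf{b}C$; (v) $A\bar{\mathbf{b}}B$ implies that there exists $E\subseteq X$ with $A\bar{\mathbf{b}}E$ and $(X\setminus E)\bar{\mathbf{b}}B$. $B$ is a $\mathbf{b}$-coarse neighborhood of $A$ if $A\bar{\mathbf{b}}(X\setminus B)$. *)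

theory Defs
  imports Main
begin

definition bornology :: "'a set \<Rightarrow> 'a set set \<Rightarrow> bool" where
  "bornology X \<B> \<longleftrightarrow>
     \<B> \<subseteq> Pow X \<and>
     (\<forall>x\<in>X. {x} \<in> \<B>) \<and>
     (\<forall>A B. A \<in> \<B> \<longrightarrow> B \<subseteq> A \<longrightarrow> B \<in> \<B>) \<and>
     (\<forall>A B. A \<in> \<B> \<longrightarrow> B \<in> \<B> \<longrightarrow> A \<union> B \<in> \<B>)"

(* A relation on the power set of X is a predicate on pairs of sets; only its values
   on subsets of X matter, and nothing is required of it elsewhere. *)
definition coarse_proximity :: "'a set \<Rightarrow> 'a set set \<Rightarrow> ('a set \<Rightarrow> 'a set \<Rightarrow> bool) \<Rightarrow> bool" where
  "coarse_proximity X \<B> b \<longleftrightarrow>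
     (\<forall>A\<subseteq>X. \<forall>B\<subseteq>X. b A B \<longrightarrow> b B A) \<and>
     (\<forall>A\<subseteq>X. \<forall>B\<subseteq>X. b A B \<longrightarrow> A \<notin> \<B> \<and> B \<notin> \<B>) \<and>
     (\<forall>A\<subseteq>X. \<forall>B\<subseteq>X. A \<inter> B \<notin> \<B> \<longrightarrow> b A B) \<and>
     (\<forall>A\<subseteq>X. \<forall>B\<subseteq>X. \<forall>C\<subseteq>X. b (A \<union> B) C \<longleftrightarrow> b A C \<or> b B C) \<and>
     (\<forall>A\<subseteq>X. \<forall>B\<subseteq>X. \<not> b A B \<longrightarrow> (\<exists>E\<subseteq>X. \<not> b A E \<and> \<not> b (X - E) B))"

(* coarse_neighborhood X b A B: B is a b-coarse neighborhood of A. *)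
definition coarse_neighborhood ::
    "'a set \<Rightarrow> ('a set \<Rightarrow> 'a set \<Rightarrow> bool) \<Rightarrow> 'a set \<Rightarrow> 'a set \<Rightarrow> bool" where
  "coarse_neighborhood X b A B \<longleftrightarrow> A \<subseteq> X \<and> B \<subseteq> X \<and> \<not> b A (X - B)"

end

theory Submission
  imports Defs
begin

text \<open>
  Each proximity axiom is one of the axioms of the relation \<open>\<lless>\<close> read through
  the definition of \<open>b\<close>. Complementation (\<open>ax5\<close>) is symmetry; by it, the union
  in the first argument of \<open>b\<close> becomes an intersection on the right of \<open>\<lless>\<close>, so
  that \<open>ax4\<close> is additivity. A bounded set is far from every set because \<open>ax1\<close>
  and monotonicity (\<open>ax3\<close>) give \<open>B \<lless> X - D\<close> for every \<open>B \<subseteq> X\<close> and bounded \<open>D\<close>,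
  while \<open>ax2\<close> says that far sets meet in a bounded set. Interpolation (\<open>ax6\<close>) is
  the strong axiom, with the complement of the interpolant as the separating set.
\<close>

theorem theorem2p5:
  fixes X :: "'a set" and \<B> :: "'a set set"
    and ll :: "'a set \<Rightarrow> 'a set \<Rightarrow> bool"  (infix "\<lless>" 50)
    and b :: "'a set \<Rightarrow> 'a set \<Rightarrow> bool"
  assumes born: "bornology X \<B>"
    and ax1: "\<And>D. D \<in> \<B> \<Longrightarrow> X \<lless> (X - D)"
    and ax2: "\<And>A B. \<lbrakk>A \<subseteq> X; B \<subseteq> X; A \<lless> B\<rbrakk> \<Longrightarrow> \<exists>D\<in>\<B>. A - D \<subseteq> B"
    and ax3: "\<And>A B C D. \<lbrakk>A \<subseteq> X; B \<subseteq> X; C \<subseteq> X; D \<subseteq> X; A \<subseteq> B; B \<lless> C; C \<subseteq> D\<rbrakk> \<Longrightarrow> A \<lless> D"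
    and ax4: "\<And>A B1 B2. \<lbrakk>A \<subseteq> X; B1 \<subseteq> X; B2 \<subseteq> X\<rbrakk> \<Longrightarrow>
                (A \<lless> B1 \<and> A \<lless> B2) \<longleftrightarrow> A \<lless> (B1 \<inter> B2)"
    and ax5: "\<And>A B. \<lbrakk>A \<subseteq> X; B \<subseteq> X\<rbrakk> \<Longrightarrow> A \<lless> B \<longleftrightarrow> (X - B) \<lless> (X - A)"
    and ax6: "\<And>A B. \<lbrakk>A \<subseteq> X; B \<subseteq> X; A \<lless> B\<rbrakk> \<Longrightarrow> \<exists>C\<subseteq>X. A \<lless> C \<and> C \<lless> B"
    and b_iff: "\<And>A B. \<lbrakk>A \<subseteq> X; B \<subseteq> X\<rbrakk> \<Longrightarrow> \<not> b A B \<longleftrightarrow> A \<lless> (X - B)"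
  shows "coarse_proximity X \<B> b \<and>
         (\<forall>A\<subseteq>X. \<forall>B\<subseteq>X. coarse_neighborhood X b A B \<longleftrightarrow> A \<lless> B)"
proof -
  have sym: "\<not> b A B \<longleftrightarrow> \<not> b B A" if "A \<subseteq> X" "B \<subseteq> X" for A B
  proof -
    have "A \<lless> (X - B) \<longleftrightarrow> (X - (X - B)) \<lless> (X - A)"
      using that by (intro ax5) auto
    then show ?thesis
      using that by (simp add: b_iff double_diff)
  qed
  have bounded_far: "\<not> b B A" if "A \<in> \<B>" "A \<subseteq> X" "B \<subseteq> X" for A B
  proof -
    have "B \<lless> (X - A)"
      using ax3[of B X "X - A" "X - A"] ax1[of A] that by auto
    then show ?thesis
      using that by (simp add: b_iff)
  qed
  have far_meet: "A \<inter> B \<in> \<B>" if "A \<subseteq> X" "B \<subseteq> X" "\<not> b A B" for A B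
  proof -
    have "A \<lless> (X - B)"
      using that by (simp add: b_iff)
    then obtain D where D: "D \<in> \<B>" "A - D \<subseteq> X - B"
      using ax2[of A "X - B"] \<open>A \<subseteq> X\<close> by blast
    then have "A \<inter> B \<subseteq> D"
      by blast
    with D(1) born show ?thesis
      unfolding bornology_def by blast
  qed
  have union: "\<not> b (A \<union> B) C \<longleftrightarrow> \<not> b A C \<and> \<not> b B C"
    if "A \<subseteq> X" "B \<subseteq> X" "C \<subseteq> X" for A B C
  proof -
    have "\<not> b C (A \<union> B) \<longleftrightarrow> C \<lless> ((X - A) \<inter> (X - B))"
      using that by (simp add: b_iff Diff_Un)
    also have "\<dots> \<longleftrightarrow> \<not> b C A \<and> \<not> b C B"
      using that ax4[of C "X - A" "X - B"] by (auto simp: b_iff)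
    finally show ?thesis
      using that sym[of "A \<union> B" C] sym[of A C] sym[of B C] by simp
  qed
  have strong: "\<exists>E\<subseteq>X. \<not> b A E \<and> \<not> b (X - E) B"
    if "A \<subseteq> X" "B \<subseteq> X" "\<not> b A B" for A B
  proof -
    have "A \<lless> (X - B)"
      using that by (simp add: b_iff)
    then obtain C where "C \<subseteq> X" "A \<lless> C" "C \<lless> (X - B)"
      using ax6[of A "X - B"] \<open>A \<subseteq> X\<close> by blast
    then have "\<not> b A (X - C) \<and> \<not> b (X - (X - C)) B"
      using that by (simp add: b_iff double_diff)
    then show ?thesis
      by blast
  qed
  have nbhd: "coarse_neighborhood X b A B \<longleftrightarrow> A \<lless> B" if "A \<subseteq> X" "B \<subseteq> X" for A B
    using that by (simp add: coarse_neighborhood_def b_iff double_diff)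
  have "coarse_proximity X \<B> b"
    unfolding coarse_proximity_def
  proof (intro conjI)
    show "\<forall>A\<subseteq>X. \<forall>B\<subseteq>X. b A B \<longrightarrow> b B A"
      using sym by blast
    show "\<forall>A\<subseteq>X. \<forall>B\<subseteq>X. b A B \<longrightarrow> A \<notin> \<B> \<and> B \<notin> \<B>"
      using sym bounded_far by blast
    show "\<forall>A\<subseteq>X. \<forall>B\<subseteq>X. A \<inter> B \<notin> \<B> \<longrightarrow> b A B"
      using far_meet by blast
    show "\<forall>A\<subseteq>X. \<forall>B\<subseteq>X. \<forall>C\<subseteq>X. b (A \<union> B) C \<longleftrightarrow> b A C \<or> b B C"
      using union by blast
    show "\<forall>A\<subseteq>X. \<forall>B\<subseteq>X. \<not> b A B \<longrightarrow> (\<exists>E\<subseteq>X. \<not> b A E \<and> \<not> b (X - E) B)"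
      using strong by blast
  qed
  with nbhd show ?thesis
    by blast
qed

end
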